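(* Let $\{\eta^i_q\in V_{\mathbb{H}}^R \mid i=1,\dots,n,\ q\in\mathbb{H}\}$ be a rank $n$ right quaternionic continuous frame with frame operator $A$ and bounds $m(A)$, $M(A)$, and let $\{\overline{\eta}^i_q\in V_{\mathbb{H}}^R \mid i=1,\dots,n,\ q\in\mathbb{H}\}$ be a dual frame of $\{\eta^i_q\}$ with bounds $C,D$. Assume that the family $\{\Psi^i_q\in V_{\mathbb{H}}^R \mid i=1,\dots,n,\ q\in\mathbb{H}\}$ satisfies the following two conditions: (1) $\lambda:=\sum_{i=1}^{n}\int_{\mathbb{H}}\|\eta^i_q-\Psi^i_q\|^{2}\,d\mu(q)<\infty$; (2) $\gamma:=\sum_{i=1}^{n}\int_{\mathbb{H}}\|\eta^i_q-\Psi^i_q\|\,\|\overline{\eta}^i_q\|\,d\mu(q)<1$. Then $\{\Psi^i_q \mid i=1,\dots,n,\ q\in\mathbb{H}\}$ is a rank $n$ continuous frame for $V_{\mathbb{H}}^R$ with bounds $\frac{(1-\gamma)^{2}}{D}$ and $M(A)\left(1+\sqrt{\frac{\lambda}{M(A)}}\right)^{2}$.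
   Context: $\mathbb{H}$ denotes the quaternions, equipped with a fixed measure $\mu$; $n\ge 1$ is an integer. $V_{\mathbb{H}}^R$ is a separable right quaternionic Hilbert space, whose inner product $\langle\cdot|\cdot\rangle$ is $\mathbb{H}$-valued with $\overline{\langle\phi|\psi\rangle}=\langle\psi|\phi\rangle$, $\langle\phi|\psi p\rangle=\langle\phi|\psi\rangle p$, $\langle\phi p|\psi\rangle=\overline{p}\langle\phi|\psi\rangle$. Operators are right linear. Families are assumed measurable in $q$ so that the integrals make sense; vector and operator integrals are understood weakly, with $|\eta\rangle\langle\zeta|\,\phi=\eta\langle\zeta|\phi\rangle$. Rank $n$ right quaternionic continuous frame: a family $\{\eta^i_q\}$ such that for each $q$ the vectors $\eta^1_q,\dots,\eta^n_q$ are linearly independent, and there is a positive operator $A$ on $V_{\mathbb{H}}^R$, bounded with bounded inverse, with $\sum_{i=1}^n\int_{\mathbb{H}}|\eta^i_q\rangle\langle\eta^i_q|\,d\mu(q)=A$. $A$ is its frame operator, and its bounds are $m(A)=\inf_{\|\phi\|=1}\langle\phi|A\phi\rangle$ and $M(A)=\sup_{\|\phi\|=1}\langle\phi|A\phi\rangle$. Rank $n$ continuous frame with bounds $C,D$ (for a general family $\{\xi^i_q\}$, no linear independence required): constants $C,D>0$ with $C\|\phi\|^2\le\sum_{i=1}^n\int_{\mathbb{H}}|\langle\xi^i_q|\phi\rangle|^2\,d\mu(q)\le D\|\phi\|^2$ for all $\phi\in V_{\mathbb{H}}^R$. Dual frame of $\{\eta^i_q\}$ with bounds $C,D$: a rank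 $n$ continuous frame $\{\overline{\eta}^i_q\}$ with bounds $C,D$ (the bar is only notation) such that $\phi=\sum_{i=1}^n\int_{\mathbb{H}}\eta^i_q\langle\overline{\eta}^i_q|\phi\rangle\,d\mu(q)$ for all $\phi\in V_{\mathbb{H}}^R$. *)

theory Defs
  imports "HOL-Analysis.Analysis"
begin

section \<open>The quaternions\<close>

codatatype quat = Quat (qRe: real) (qIm1: real) (qIm2: real) (qIm3: real)

lemma quat_eqI [intro?]:
  "\<lbrakk>qRe x = qRe y; qIm1 x = qIm1 y; qIm2 x = qIm2 y; qIm3 x = qIm3 y\<rbrakk> \<Longrightarrow> x = y"
  by (rule quat.expand) simp

lemma quat_eq_iff:
  "x = y \<longleftrightarrow> qRe x = qRe y \<and> qIm1 x = qIm1 y \<and> qIm2 x = qIm2 y \<and> qIm3 x = qIm3 y"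
  by (auto intro: quat.expand)

instantiation quat :: ab_group_add
begin

primcorec zero_quat where
  "qRe 0 = 0" | "qIm1 0 = 0" | "qIm2 0 = 0" | "qIm3 0 = 0"

primcorec plus_quat where
  "qRe (x + y) = qRe x + qRe y"
| "qIm1 (x + y) = qIm1 x + qIm1 y"
| "qIm2 (x + y) = qIm2 x + qIm2 y"
| "qIm3 (x + y) = qIm3 x + qIm3 y"

primcorec uminus_quat where
  "qRe (- x) = - qRe x"
| "qIm1 (- x) = - qIm1 x"
| "qIm2 (- x) = - qIm2 x"
| "qIm3 (- x) = - qIm3 x"

primcorec minus_quat where
  "qRe (x - y) = qRe x - qRe y"
| "qIm1 (x - y) = qIm1 x - qIm1 y"
| "qIm2 (x - y) = qIm2 x - qIm2 y"
| "qIm3 (x - y) = qIm3 x - qIm3 y"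

instance
  by standard (simp_all add: quat_eq_iff)

end

instantiation quat :: ring_1
begin

primcorec one_quat where
  "qRe 1 = 1" | "qIm1 1 = 0" | "qIm2 1 = 0" | "qIm3 1 = 0"

primcorec times_quat where
  "qRe (x * y) = qRe x * qRe y - qIm1 x * qIm1 y - qIm2 x * qIm2 y - qIm3 x * qIm3 y"
| "qIm1 (x * y) = qRe x * qIm1 y + qIm1 x * qRe y + qIm2 x * qIm3 y - qIm3 x * qIm2 y"
| "qIm2 (x * y) = qRe x * qIm2 y - qIm1 x * qIm3 y + qIm2 x * qRe y + qIm3 x * qIm1 y"
| "qIm3 (x * y) = qRe x * qIm3 y + qIm1 x * qIm2 y - qIm2 x * qIm1 y + qIm3 x * qRe y"

instance
  by standard (simp_all add: quat_eq_iff algebra_simps)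

end

lemma quat_unit_relations:
  defines "i \<equiv> Quat 0 1 0 0" and "j \<equiv> Quat 0 0 1 0" and "k \<equiv> Quat 0 0 0 1"
  shows "i * i = -1" "j * j = -1" "k * k = -1" "i * j = k" "j * k = i" "k * i = j"
  by (simp_all add: quat_eq_iff assms)

instantiation quat :: real_algebra_1
begin

primcorec scaleR_quat where
  "qRe (scaleR r x) = r * qRe x"
| "qIm1 (scaleR r x) = r * qIm1 x"
| "qIm2 (scaleR r x) = r * qIm2 x"
| "qIm3 (scaleR r x) = r * qIm3 x"

instance
  by standard (simp_all add: quat_eq_iff algebra_simps)

end

lemma of_real_quat_sel [simp]:
  "qRe (of_real r) = r" "qIm1 (of_real r) = 0" "qIm2 (of_real r) = 0" "qIm3 (of_real r) = 0"
  by (simp_all add: of_real_def)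

primcorec qcnj :: "quat \<Rightarrow> quat" where
  "qRe (qcnj x) = qRe x"
| "qIm1 (qcnj x) = - qIm1 x"
| "qIm2 (qcnj x) = - qIm2 x"
| "qIm3 (qcnj x) = - qIm3 x"

instantiation quat :: real_inner
begin

definition inner_quat :: "quat \<Rightarrow> quat \<Rightarrow> real" where
  "inner_quat x y = qRe x * qRe y + qIm1 x * qIm1 y + qIm2 x * qIm2 y + qIm3 x * qIm3 y"

definition norm_quat :: "quat \<Rightarrow> real" where
  "norm_quat x = sqrt (inner x x)"

definition sgn_quat :: "quat \<Rightarrow> quat" where
  "sgn_quat x = x /\<^sub>R norm x"

definition dist_quat :: "quat \<Rightarrow> quat \<Rightarrow> real" where
  "dist_quat x y = norm (x - y)"

definition uniformity_quat :: "(quat \<times> quat) filter" where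
  "uniformity_quat = (INF e\<in>{0 <..}. principal {(x, y). dist x y < e})"

definition open_quat :: "quat set \<Rightarrow> bool" where
  "open_quat U \<longleftrightarrow> (\<forall>x\<in>U. eventually (\<lambda>(x', y). x' = x \<longrightarrow> y \<in> U) uniformity)"

instance
proof
  fix x y z :: quat and r :: real
  show "inner x x = 0 \<longleftrightarrow> x = 0"
    by (auto simp: inner_quat_def quat_eq_iff add_nonneg_eq_0_iff)
qed (simp_all add: inner_quat_def norm_quat_def sgn_quat_def dist_quat_def
      uniformity_quat_def open_quat_def algebra_simps)

end

lemma norm_quat_eq: "norm x = sqrt ((qRe x)\<^sup>2 + (qIm1 x)\<^sup>2 + (qIm2 x)\<^sup>2 + (qIm3 x)\<^sup>2)"
  by (simp add: norm_quat_def inner_quat_def power2_eq_square)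

instantiation quat :: real_normed_div_algebra
begin

definition inverse_quat :: "quat \<Rightarrow> quat" where
  "inverse_quat x = qcnj x /\<^sub>R (norm x)\<^sup>2"

definition divide_quat :: "quat \<Rightarrow> quat \<Rightarrow> quat" where
  "divide_quat x y = x * inverse y"

instance
proof
  fix x y :: quat
  have qcnj: "qcnj x * x = of_real ((norm x)\<^sup>2)" "x * qcnj x = of_real ((norm x)\<^sup>2)"
    by (simp_all add: quat_eq_iff norm_quat_eq power2_eq_square algebra_simps)
  show "x \<noteq> 0 \<Longrightarrow> inverse x * x = 1" "x \<noteq> 0 \<Longrightarrow> x * inverse x = 1"
    unfolding inverse_quat_def mult_scaleR_left mult_scaleR_right qcnj
    by (simp_all add: quat_eq_iff del: of_real_power)
  have "inner (x * y) (x * y) = inner x x * inner y y"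
    by (simp add: inner_quat_def) algebra
  then show "norm (x * y) = norm x * norm y"
    by (simp only: norm_quat_def real_sqrt_mult)
qed (simp_all add: inverse_quat_def divide_quat_def quat_eq_iff)

end

instantiation quat :: euclidean_space
begin

definition Basis_quat :: "quat set" where
  "Basis_quat = {Quat 1 0 0 0, Quat 0 1 0 0, Quat 0 0 1 0, Quat 0 0 0 1}"

instance
proof
  fix x u v :: quat
  show "Basis \<noteq> ({} :: quat set)" "finite (Basis :: quat set)"
    by (simp_all add: Basis_quat_def)
  show "(\<forall>u\<in>Basis. inner x u = 0) \<longleftrightarrow> x = 0"
    by (simp add: Basis_quat_def inner_quat_def) (simp add: quat_eq_iff)
  assume "u \<in> Basis" "v \<in> Basis"
  then show "inner u v = (if u = v then 1 else 0)"
    unfolding Basis_quat_def by (elim insertE emptyE) (simp_all add: inner_quat_def)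
qed

end


section \<open>Separable right quaternionic Hilbert spaces\<close>

text \<open>
  The whole type is the Hilbert space. Its real vector space structure is the one induced by the
  embedding of \<open>\<real>\<close> in the quaternions, and its norm, metric and topology are those of the
  quaternionic inner product.
\<close>

class right_quat_inner = real_normed_vector +
  fixes rscale :: "'a \<Rightarrow> quat \<Rightarrow> 'a"  (infixl \<open>\<cdot>\<^sub>q\<close> 75)
    and qinner :: "'a \<Rightarrow> 'a \<Rightarrow> quat"
  assumes rscale_add_left: "(x + y) \<cdot>\<^sub>q p = x \<cdot>\<^sub>q p + y \<cdot>\<^sub>q p"
    and rscale_add_right: "x \<cdot>\<^sub>q (p + r) = x \<cdot>\<^sub>q p + x \<cdot>\<^sub>q r"
    and rscale_mult: "x \<cdot>\<^sub>q (p * r) = (x \<cdot>\<^sub>q p) \<cdot>\<^sub>q r"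
    and rscale_one: "x \<cdot>\<^sub>q 1 = x"
    and scaleR_eq_rscale: "scaleR a x = x \<cdot>\<^sub>q of_real a"
    and qinner_commute: "qcnj (qinner x y) = qinner y x"
    and qinner_add_right: "qinner x (y + z) = qinner x y + qinner x z"
    and qinner_rscale_right: "qinner x (y \<cdot>\<^sub>q p) = qinner x y * p"
    and qinner_rscale_left: "qinner (x \<cdot>\<^sub>q p) y = qcnj p * qinner x y"
    and qinner_ge_zero: "0 \<le> qRe (qinner x x)"
    and qinner_eq_zero_iff: "qinner x x = 0 \<longleftrightarrow> x = 0"
    and norm_eq_sqrt_qinner: "norm x = sqrt (qRe (qinner x x))"

class right_quat_hilbert = right_quat_inner + complete_space +
  assumes separable: "\<exists>S. countable S \<and> (\<forall>x. \<forall>e>0. \<exists>s\<in>S. dist s x < e)"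

instance right_quat_hilbert \<subseteq> banach ..

instance right_quat_hilbert \<subseteq> second_countable_topology
proof
  obtain S :: "'a set" where S: "countable S" "\<And>x e. e > 0 \<Longrightarrow> \<exists>s\<in>S. dist s x < e"
    using separable by blast
  define B where "B = (\<lambda>(x::'a, e). ball x e) ` (S \<times> (\<rat> \<inter> {0<..}))"
  have "countable B"
    unfolding B_def using S(1) countable_rat by (intro countable_image countable_SIGMA) auto
  moreover have "topological_basis B"
  proof (rule topological_basisI)
    show "open U" if "U \<in> B" for U
      using that by (auto simp: B_def)
    fix U :: "'a set" and x assume "open U" "x \<in> U"
    then obtain e where e: "e > 0" "ball x e \<subseteq> U"
      by (meson open_contains_ball)
    obtain r where r: "r \<in> \<rat>" "0 < r" "r < e / 2"
      using Rats_dense_in_real [of 0 "e / 2"] e(1) by auto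
    obtain s where s: "s \<in> S" "dist s x < r"
      using S(2) r(2) by blast
    have "ball s r \<subseteq> ball x e"
    proof
      fix y assume "y \<in> ball s r"
      then show "y \<in> ball x e"
        using s(2) r(3) dist_triangle [of x y s] by (simp add: dist_commute)
    qed
    with s r e show "\<exists>V\<in>B. x \<in> V \<and> V \<subseteq> U"
      by (intro bexI [of _ "ball s r"]) (auto simp: B_def)
  qed
  ultimately show "\<exists>B :: 'a set set. countable B \<and> open = generate_topology B"
    by (auto simp: topological_basis_imp_subbasis)
qed

instantiation quat :: right_quat_hilbert
begin

definition rscale_quat :: "quat \<Rightarrow> quat \<Rightarrow> quat" where
  "rscale_quat x p = x * p"

definition qinner_quat :: "quat \<Rightarrow> quat \<Rightarrow> quat" where
  "qinner_quat x y = qcnj x * y"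

instance
proof
  fix x :: quat
  show "qinner x x = 0 \<longleftrightarrow> x = 0"
    by (auto simp: qinner_quat_def quat_eq_iff add_nonneg_eq_0_iff)
  obtain S :: "quat set" where "countable S" and S: "\<And>U. open U \<Longrightarrow> U \<noteq> {} \<Longrightarrow> \<exists>s\<in>S. s \<in> U"
    using countable_dense_exists by metis
  moreover have "\<exists>s\<in>S. dist s x < e" if "e > 0" for x e
    using S [of "ball x e"] that by (auto simp: dist_commute)
  ultimately show "\<exists>S :: quat set. countable S \<and> (\<forall>x. \<forall>e>0. \<exists>s\<in>S. dist s x < e)"
    by blast
  show "norm x = sqrt (qRe (qinner x x))"
    by (simp add: qinner_quat_def norm_quat_eq power2_eq_square)
qed (simp_all add: rscale_quat_def qinner_quat_def quat_eq_iff algebra_simps)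

end


section \<open>Right linear operators\<close>

definition right_linear :: "('v::right_quat_inner \<Rightarrow> 'v) \<Rightarrow> bool" where
  "right_linear T \<longleftrightarrow> (\<forall>x y. T (x + y) = T x + T y) \<and> (\<forall>x p. T (x \<cdot>\<^sub>q p) = T x \<cdot>\<^sub>q p)"

definition bounded_right_linear :: "('v::right_quat_inner \<Rightarrow> 'v) \<Rightarrow> bool" where
  "bounded_right_linear T \<longleftrightarrow> right_linear T \<and> (\<exists>K. \<forall>x. norm (T x) \<le> K * norm x)"

text \<open>Membership in \<open>\<real>\<close> here means being a real quaternion, so the last clause is
  \<open>\<langle>x|T x\<rangle> \<ge> 0\<close>.\<close>

definition positive_operator :: "('v::right_quat_inner \<Rightarrow> 'v) \<Rightarrow> bool" where
  "positive_operator T \<longleftrightarrow> right_linear T \<and> (\<forall>x y. qinner (T x) y = qinner x (T y)) \<and>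
    (\<forall>x. qinner x (T x) \<in> \<real> \<and> 0 \<le> qRe (qinner x (T x)))"

definition bounded_with_bounded_inverse :: "('v::right_quat_inner \<Rightarrow> 'v) \<Rightarrow> bool" where
  "bounded_with_bounded_inverse T \<longleftrightarrow> bounded_right_linear T \<and>
    (\<exists>S. bounded_right_linear S \<and> (\<forall>x. S (T x) = x) \<and> (\<forall>x. T (S x) = x))"

text \<open>The bounds $m(T)$ and $M(T)$ of a positive operator.\<close>

definition operator_inf :: "('v::right_quat_inner \<Rightarrow> 'v) \<Rightarrow> real" where
  "operator_inf T = (INF x\<in>{x. norm x = 1}. qRe (qinner x (T x)))"

definition operator_sup :: "('v::right_quat_inner \<Rightarrow> 'v) \<Rightarrow> real" where
  "operator_sup T = (SUP x\<in>{x. norm x = 1}. qRe (qinner x (T x)))"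

definition ket_bra :: "'v::right_quat_inner \<Rightarrow> 'v \<Rightarrow> 'v \<Rightarrow> 'v" where
  "ket_bra \<eta> \<zeta> \<phi> = \<eta> \<cdot>\<^sub>q qinner \<zeta> \<phi>"


section \<open>Rank n continuous frames\<close>

text \<open>
  Families are indexed by $\{1,\dots,n\}$ and the points of a measure space; values at other
  indices are irrelevant. The weak sense of $\sum_{i=1}^n \int f^i_q \, d\mu(q) = v$:
\<close>

definition has_weak_integral_sum ::
    "'q measure \<Rightarrow> nat \<Rightarrow> (nat \<Rightarrow> 'q \<Rightarrow> 'v::right_quat_inner) \<Rightarrow> 'v \<Rightarrow> bool" where
  "has_weak_integral_sum \<mu> n f v \<longleftrightarrow>
    (\<forall>\<psi>. (\<forall>i\<in>{1..n}. integrable \<mu> (\<lambda>q. qinner \<psi> (f i q))) \<and>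
         (\<Sum>i=1..n. \<integral>q. qinner \<psi> (f i q) \<partial>\<mu>) = qinner \<psi> v)"

definition measurable_family ::
    "'q measure \<Rightarrow> nat \<Rightarrow> (nat \<Rightarrow> 'q \<Rightarrow> 'v::right_quat_inner) \<Rightarrow> bool" where
  "measurable_family \<mu> n f \<longleftrightarrow> (\<forall>i\<in>{1..n}. f i \<in> borel_measurable \<mu>)"

definition right_independent :: "nat \<Rightarrow> (nat \<Rightarrow> 'v::right_quat_inner) \<Rightarrow> bool" where
  "right_independent n v \<longleftrightarrow>
    (\<forall>c. (\<Sum>i=1..n. v i \<cdot>\<^sub>q c i) = 0 \<longrightarrow> (\<forall>i\<in>{1..n}. c i = 0))"

definition rank_frame_with_operator ::
    "quat measure \<Rightarrow> nat \<Rightarrow> (nat \<Rightarrow> quat \<Rightarrow> 'v::right_quat_hilbert) \<Rightarrow> ('v \<Rightarrow> 'v) \<Rightarrow> bool" where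
  "rank_frame_with_operator \<mu> n \<eta> A \<longleftrightarrow>
    measurable_family \<mu> n \<eta> \<and>
    (\<forall>q. right_independent n (\<lambda>i. \<eta> i q)) \<and>
    positive_operator A \<and> bounded_with_bounded_inverse A \<and>
    (\<forall>\<phi>. has_weak_integral_sum \<mu> n (\<lambda>i q. ket_bra (\<eta> i q) (\<eta> i q) \<phi>) (A \<phi>))"

definition rank_frame_with_bounds ::
    "quat measure \<Rightarrow> nat \<Rightarrow> (nat \<Rightarrow> quat \<Rightarrow> 'v::right_quat_hilbert) \<Rightarrow> real \<Rightarrow> real \<Rightarrow> bool" where
  "rank_frame_with_bounds \<mu> n \<xi> C D \<longleftrightarrow>
    measurable_family \<mu> n \<xi> \<and> 0 < C \<and> 0 < D \<and>
    (\<forall>\<phi>. ennreal (C * (norm \<phi>)\<^sup>2) \<le> (\<Sum>i=1..n. \<integral>\<^sup>+ q. ennreal ((norm (qinner (\<xi> i q) \<phi>))\<^sup>2) \<partial>\<mu>) \<and>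
         (\<Sum>i=1..n. \<integral>\<^sup>+ q. ennreal ((norm (qinner (\<xi> i q) \<phi>))\<^sup>2) \<partial>\<mu>) \<le> ennreal (D * (norm \<phi>)\<^sup>2))"

definition dual_frame_with_bounds ::
    "quat measure \<Rightarrow> nat \<Rightarrow> (nat \<Rightarrow> quat \<Rightarrow> 'v::right_quat_hilbert) \<Rightarrow> (nat \<Rightarrow> quat \<Rightarrow> 'v) \<Rightarrow>
      real \<Rightarrow> real \<Rightarrow> bool" where
  "dual_frame_with_bounds \<mu> n \<eta> \<theta> C D \<longleftrightarrow>
    rank_frame_with_bounds \<mu> n \<theta> C D \<and>
    (\<forall>\<phi>. has_weak_integral_sum \<mu> n (\<lambda>i q. \<eta> i q \<cdot>\<^sub>q qinner (\<theta> i q) \<phi>) \<phi>)"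

end

theory Submission
  imports Defs
begin

text \<open>
  Reconstruction of \<open>\<phi>\<close> from the dual frame gives
  $\|\phi\|^2 = |\sum_i \int \langle\phi|\eta^i_q\rangle\langle\overline\eta^i_q|\phi\rangle|$; replacing
  \<open>\<eta>\<close> by \<open>\<Psi>\<close> costs at most $\gamma\|\phi\|^2$, and the remaining term is controlled by a
  weighted arithmetic-geometric mean inequality, with the weight chosen so that the part coming
  from \<open>D\<close> is absorbed by the left-hand side. The upper bound is Minkowski's inequality, since
  \<open>M(A)\<close> is an upper bound for the frame \<open>\<eta>\<close>.
\<close>

section \<open>Quaternionic inner product: Cauchy-Schwarz, continuity, measurability\<close>

lemma qcnj_mult_self: "qcnj p * p = of_real ((norm p)\<^sup>2)"
  by (simp add: quat_eq_iff norm_quat_eq power2_eq_square algebra_simps)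

lemma norm_qcnj [simp]: "norm (qcnj p) = norm p"
  by (simp add: norm_quat_eq)

lemma qcnj_diff: "qcnj (x - y) = qcnj x - qcnj y"
  by (simp add: quat_eq_iff)

text \<open>Allows real parts to be exchanged with Bochner integrals of quaternion-valued
  functions.\<close>

lemma bounded_linear_qRe: "bounded_linear qRe"
proof -
  have "qRe = (\<lambda>x. inner x 1)"
    by (auto simp: inner_quat_def)
  then show ?thesis
    using bounded_linear_inner_left [of "1::quat"] by simp
qed

lemma abs_qRe_le_norm: "\<bar>qRe x\<bar> \<le> norm x"
  unfolding norm_quat_eq by (intro real_le_rsqrt) simp

lemma qinner_zero_right [simp]:
  fixes x :: "'v::right_quat_inner"
  shows "qinner x 0 = 0"
  using qinner_add_right [of x 0 0] by simp

lemma qinner_diff_right: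
  fixes x :: "'v::right_quat_inner"
  shows "qinner x (y - z) = qinner x y - qinner x z"
  using qinner_add_right [of x "y - z" z] by simp

lemma qinner_diff_left:
  fixes x :: "'v::right_quat_inner"
  shows "qinner (x - y) z = qinner x z - qinner y z"
  by (metis qcnj_diff qinner_commute qinner_diff_right)

lemma norm_qinner_commute:
  fixes x :: "'v::right_quat_inner"
  shows "norm (qinner x y) = norm (qinner y x)"
  by (metis norm_qcnj qinner_commute)

text \<open>Invariance under conjugation kills the three imaginary parts; the real part is the
  squared norm by the axiom on the norm.\<close>

lemma qinner_self:
  fixes x :: "'v::right_quat_inner"
  shows "qinner x x = of_real ((norm x)\<^sup>2)"
proof -
  have "qcnj (qinner x x) = qinner x x"
    by (rule qinner_commute)
  then show ?thesis
    using qinner_ge_zero [of x] by (simp add: quat_eq_iff norm_eq_sqrt_qinner)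
qed

text \<open>Cauchy-Schwarz, from nonnegativity of the squared norm of the residual of
  \<open>y\<close> after projection onto the right line through \<open>x\<close>. Quaternions do not
  commute, so the cross terms are compared through their real parts only.\<close>

lemma norm_qinner_le:
  fixes x :: "'v::right_quat_inner"
  shows "norm (qinner x y) \<le> norm x * norm y"
proof (cases "x = 0")
  case True
  then show ?thesis
    by (metis mult_zero_left norm_qinner_commute norm_zero order_refl qinner_zero_right)
next
  case False
  then have nx: "norm x \<noteq> 0"
    by simp
  define p where "p = qinner x y"
  define r where "r = inverse ((norm x)\<^sup>2)"
  \<comment> \<open>\<open>x \<cdot>\<^sub>q s\<close> is the orthogonal projection of
    \<open>y\<close>. With this coefficient both cross terms and the quadratic term have real part
    \<open>r * (norm p)\<^sup>2\<close>, so one copy survives with a minus sign.\<close>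
  define s where "s = p * of_real r"
  have yx: "qinner y x = qcnj p"
    by (simp add: p_def qinner_commute)
  have "qinner (y - x \<cdot>\<^sub>q s) (y - x \<cdot>\<^sub>q s)
      = of_real ((norm y)\<^sup>2) - qcnj p * s - qcnj s * p + qcnj s * of_real ((norm x)\<^sup>2) * s"
    unfolding qinner_diff_left qinner_diff_right qinner_rscale_left qinner_rscale_right
    by (simp add: yx qinner_self p_def [symmetric] algebra_simps del: of_real_power)
  moreover have "qRe (qcnj p * s) = r * (norm p)\<^sup>2" "qRe (qcnj s * p) = r * (norm p)\<^sup>2"
    "qRe (qcnj s * of_real ((norm x)\<^sup>2) * s) = r * (norm p)\<^sup>2 * (r * (norm x)\<^sup>2)"
    by (simp_all add: s_def norm_quat_eq [of p] power2_eq_square algebra_simps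
          del: of_real_power of_real_mult)
  moreover have "r * (norm x)\<^sup>2 = 1"
    using nx by (simp add: r_def)
  ultimately have "0 \<le> (norm y)\<^sup>2 - r * (norm p)\<^sup>2"
    using qinner_ge_zero [of "y - x \<cdot>\<^sub>q s"] by (simp del: of_real_power)
  then have "(norm p)\<^sup>2 \<le> (norm x * norm y)\<^sup>2"
    using nx by (simp add: r_def field_simps power_mult_distrib)
  then show ?thesis
    unfolding p_def by (rule power2_le_imp_le) simp
qed

lemma bounded_linear_qinner_right: "bounded_linear (qinner x)"
  for x :: "'v::right_quat_inner"
proof (rule bounded_linear_intro [where K = "norm x"])
  \<comment> \<open>Both real scalings become right multiplication by a real quaternion: the one on
    the space, and the one on \<open>quat\<close>, seen as a Hilbert space over itself.\<close>
  show "qinner x (r *\<^sub>R y) = r *\<^sub>R qinner x y" for r y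
    by (simp add: scaleR_eq_rscale qinner_rscale_right rscale_quat_def)
qed (simp_all add: qinner_add_right norm_qinner_le mult.commute [of _ "norm x"])

text \<open>The function sits in the conjugate-linear slot; since the norm is symmetric, it can be
  moved to the slot where continuity is known.\<close>

lemma borel_measurable_norm_qinner:
  fixes f :: "'q \<Rightarrow> 'v::right_quat_inner"
  assumes "f \<in> borel_measurable M"
  shows "(\<lambda>q. norm (qinner (f q) x)) \<in> borel_measurable M"
proof -
  have "(\<lambda>q. qinner x (f q)) \<in> borel_measurable M"
    using assms linear_continuous_on [OF bounded_linear_qinner_right]
    by (rule borel_measurable_continuous_on [rotated])
  then have "(\<lambda>q. norm (qinner x (f q))) \<in> borel_measurable M"
    by measurable
  then show ?thesis
    by (simp add: norm_qinner_commute)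
qed

section \<open>Weighted Young inequality and Minkowski's inequality for sums of integrals\<close>

lemma young_weighted:
  fixes a b s :: real
  assumes "s > 0"
  shows "2 * (a * b) \<le> s * a\<^sup>2 + b\<^sup>2 / s"
proof -
  have "0 \<le> (s * a - b)\<^sup>2 / s"
    using assms by simp
  also have "\<dots> = s * a\<^sup>2 + b\<^sup>2 / s - 2 * (a * b)"
    using assms by (simp add: field_simps power2_eq_square)
  finally show ?thesis
    by simp
qed

text \<open>A pointwise bound on the square of \<open>a i q + b i q\<close>, with weights
  independent of \<open>i\<close> and \<open>q\<close>, is integrated and summed. The weights depend
  only on \<open>P\<close> and \<open>Q\<close> and are tuned so that the two given bounds add up to
  exactly the square of \<open>P + Q\<close>.\<close>

lemma sum_nn_integral_Minkowski:
  fixes a b :: "'i \<Rightarrow> 'q \<Rightarrow> real"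
  assumes I: "finite I"
    and meas: "\<And>i. i \<in> I \<Longrightarrow> a i \<in> borel_measurable M" "\<And>i. i \<in> I \<Longrightarrow> b i \<in> borel_measurable M"
    and PQ: "P > 0" "Q \<ge> 0"
    and a: "(\<Sum>i\<in>I. \<integral>\<^sup>+ q. ennreal ((a i q)\<^sup>2) \<partial>M) \<le> ennreal (P\<^sup>2)"
    and b: "(\<Sum>i\<in>I. \<integral>\<^sup>+ q. ennreal ((b i q)\<^sup>2) \<partial>M) \<le> ennreal (Q\<^sup>2)"
  shows "(\<Sum>i\<in>I. \<integral>\<^sup>+ q. ennreal ((a i q + b i q)\<^sup>2) \<partial>M) \<le> ennreal ((P + Q)\<^sup>2)"
proof (cases "Q = 0")
  \<comment> \<open>Division by zero would make the weight \<open>v\<close> equal to 1 here, and the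
    pointwise bound would fail; instead \<open>b\<close> vanishes almost everywhere.\<close>
  case True
  have "(\<integral>\<^sup>+ q. ennreal ((a i q + b i q)\<^sup>2) \<partial>M) = (\<integral>\<^sup>+ q. ennreal ((a i q)\<^sup>2) \<partial>M)"
    if i: "i \<in> I" for i
  proof -
    note [measurable] = meas [OF i]
    have "(\<integral>\<^sup>+ q. ennreal ((b i q)\<^sup>2) \<partial>M) = 0"
      using b True I i by simp
    then have "AE q in M. b i q = 0"
      by (subst (asm) nn_integral_0_iff_AE) (auto simp: ennreal_eq_0_iff)
    then show ?thesis
      by (intro nn_integral_cong_AE) auto
  qed
  then show ?thesis
    using a True by simp
next
  case False
  then have Q: "Q > 0"
    using PQ by simp
  \<comment> \<open>These come from Young's inequality with parameter \<open>Q / P\<close>, which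
    splits the cross term of the square.\<close>
  define u v where "u = 1 + Q / P" and "v = 1 + P / Q"
  have uv: "u \<ge> 0" "v \<ge> 0"
    using PQ by (simp_all add: u_def v_def)
  have pt: "(x + y)\<^sup>2 \<le> u * x\<^sup>2 + v * y\<^sup>2" for x y :: real
    using young_weighted [of "Q / P" x y] PQ Q
    by (simp add: u_def v_def power2_sum algebra_simps)
  have "(\<integral>\<^sup>+ q. ennreal ((a i q + b i q)\<^sup>2) \<partial>M)
      \<le> ennreal u * (\<integral>\<^sup>+ q. ennreal ((a i q)\<^sup>2) \<partial>M) + ennreal v * (\<integral>\<^sup>+ q. ennreal ((b i q)\<^sup>2) \<partial>M)"
    if i: "i \<in> I" for i
  proof -
    note [measurable] = meas [OF i]
    have "(\<integral>\<^sup>+ q. ennreal ((a i q + b i q)\<^sup>2) \<partial>M)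
        \<le> (\<integral>\<^sup>+ q. ennreal u * ennreal ((a i q)\<^sup>2) + ennreal v * ennreal ((b i q)\<^sup>2) \<partial>M)"
      using pt uv
      by (intro nn_integral_mono) (simp flip: ennreal_mult ennreal_plus add: ennreal_leI)
    also have "\<dots> = ennreal u * (\<integral>\<^sup>+ q. ennreal ((a i q)\<^sup>2) \<partial>M)
        + ennreal v * (\<integral>\<^sup>+ q. ennreal ((b i q)\<^sup>2) \<partial>M)"
      by (simp add: nn_integral_add nn_integral_cmult)
    finally show ?thesis .
  qed
  then have "(\<Sum>i\<in>I. \<integral>\<^sup>+ q. ennreal ((a i q + b i q)\<^sup>2) \<partial>M)
      \<le> ennreal u * (\<Sum>i\<in>I. \<integral>\<^sup>+ q. ennreal ((a i q)\<^sup>2) \<partial>M)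
        + ennreal v * (\<Sum>i\<in>I. \<integral>\<^sup>+ q. ennreal ((b i q)\<^sup>2) \<partial>M)"
    by (simp add: sum_distrib_left flip: sum.distrib) (rule sum_mono)
  also have "\<dots> \<le> ennreal u * ennreal (P\<^sup>2) + ennreal v * ennreal (Q\<^sup>2)"
    by (intro add_mono mult_left_mono a b) auto
  also have "\<dots> = ennreal (u * P\<^sup>2 + v * Q\<^sup>2)"
    using uv by (simp add: ennreal_mult)
  also have "u * P\<^sup>2 + v * Q\<^sup>2 = (P + Q)\<^sup>2"
    using PQ Q by (simp add: u_def v_def field_simps power2_eq_square)
  finally show ?thesis .
qed

section \<open>Scalar consequences of the weak operator identities\<close>

text \<open>Testing the weak integral against \<phi> itself makes the integrand a nonnegative real
  quaternion, so its integrability turns the weak identity into one between nonnegative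
  integrals.\<close>

lemma frame_operator_eq:
  fixes \<eta> :: "nat \<Rightarrow> 'q \<Rightarrow> 'v::right_quat_inner"
  assumes "has_weak_integral_sum \<mu> n (\<lambda>i q. ket_bra (\<eta> i q) (\<eta> i q) \<phi>) y"
  shows "(\<Sum>i=1..n. \<integral>\<^sup>+ q. ennreal ((norm (qinner (\<eta> i q) \<phi>))\<^sup>2) \<partial>\<mu>) = ennreal (qRe (qinner \<phi> y))"
proof -
  have eq: "qinner \<phi> (ket_bra (\<eta> i q) (\<eta> i q) \<phi>) = of_real ((norm (qinner (\<eta> i q) \<phi>))\<^sup>2)" for i q
    by (metis ket_bra_def qinner_rscale_right qinner_commute qcnj_mult_self)
  let ?f = "\<lambda>i q. (of_real ((norm (qinner (\<eta> i q) \<phi>))\<^sup>2) :: quat)"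
  let ?g = "\<lambda>i q. (norm (qinner (\<eta> i q) \<phi>))\<^sup>2"
  have int: "integrable \<mu> (?f i)" if "i \<in> {1..n}" for i
    using assms that unfolding has_weak_integral_sum_def eq [symmetric] by blast
  have sum: "(\<Sum>i=1..n. \<integral>q. ?f i q \<partial>\<mu>) = qinner \<phi> y"
    using assms unfolding has_weak_integral_sum_def eq [symmetric] by blast
  have g: "integrable \<mu> (?g i)" "qRe (\<integral>q. ?f i q \<partial>\<mu>) = (\<integral>q. ?g i q \<partial>\<mu>)" if "i \<in> {1..n}" for i
    using integrable_bounded_linear [OF bounded_linear_qRe int [OF that]]
      integral_bounded_linear [OF bounded_linear_qRe int [OF that]]
    by (simp_all del: of_real_power)
  have "(\<Sum>i=1..n. \<integral>\<^sup>+ q. ennreal (?g i q) \<partial>\<mu>) = (\<Sum>i=1..n. ennreal (\<integral>q. ?g i q \<partial>\<mu>))"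
    using g(1) by (intro sum.cong refl nn_integral_eq_integral) auto
  also have "\<dots> = ennreal (\<Sum>i=1..n. \<integral>q. ?g i q \<partial>\<mu>)"
    by (intro sum_ennreal) simp
  also have "(\<Sum>i=1..n. \<integral>q. ?g i q \<partial>\<mu>) = (\<Sum>i=1..n. qRe (\<integral>q. ?f i q \<partial>\<mu>))"
    using g(2) by (intro sum.cong refl) simp
  also have "\<dots> = qRe (\<Sum>i=1..n. \<integral>q. ?f i q \<partial>\<mu>)"
    by (simp only: linear_sum [OF bounded_linear.linear [OF bounded_linear_qRe]])
  finally show ?thesis
    using sum by simp
qed

text \<open>Homogeneity of degree two reduces the claim to unit vectors.\<close>

lemma qRe_le_operator_sup:
  fixes A :: "'v::right_quat_inner \<Rightarrow> 'v"
  assumes "bounded_right_linear A"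
  shows "qRe (qinner \<phi> (A \<phi>)) \<le> operator_sup A * (norm \<phi>)\<^sup>2"
proof (cases "\<phi> = 0")
  case True
  then show ?thesis
    using norm_qinner_le [of \<phi> "A \<phi>"] by simp
next
  case False
  define r where "r = norm \<phi>"
  define x where "x = (1 / r) *\<^sub>R \<phi>"
  have r: "r > 0"
    using False by (simp add: r_def)
  have x: "norm x = 1" and \<phi>: "\<phi> = x \<cdot>\<^sub>q of_real r"
    using r by (simp_all add: x_def r_def flip: scaleR_eq_rscale)
  obtain K where K: "\<And>x. norm (A x) \<le> K * norm x"
    using assms unfolding bounded_right_linear_def by blast
  \<comment> \<open>A supremum in the reals bounds its set only when the set is bounded above;
    boundedness of \<open>A\<close> and Cauchy-Schwarz supply this.\<close>
  have "bdd_above ((\<lambda>x. qRe (qinner x (A x))) ` {x. norm x = 1})"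
  proof (rule bdd_aboveI2 [where M = K])
    fix x :: 'v assume "x \<in> {x. norm x = 1}"
    then show "qRe (qinner x (A x)) \<le> K"
      using abs_qRe_le_norm [of "qinner x (A x)"] norm_qinner_le [of x "A x"] K [of x] by simp
  qed
  then have "qRe (qinner x (A x)) \<le> operator_sup A"
    unfolding operator_sup_def by (rule cSUP_upper [rotated]) (simp add: x)
  moreover have "A \<phi> = A x \<cdot>\<^sub>q of_real r"
    using assms by (simp add: \<phi> bounded_right_linear_def right_linear_def)
  then have "qRe (qinner \<phi> (A \<phi>)) = r\<^sup>2 * qRe (qinner x (A x))"
    by (simp add: \<phi> qinner_rscale_left qinner_rscale_right power2_eq_square algebra_simps)
  ultimately show ?thesis
    using r by (simp add: r_def mult.commute)
qed

text \<open>The reconstruction formula is tested against \<phi>, and the norm is moved inside sum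
  and integral. Absolute values suffice for the lower frame bound.\<close>

lemma dual_norm_le:
  fixes \<eta> \<theta> :: "nat \<Rightarrow> 'q \<Rightarrow> 'v::right_quat_inner"
  assumes "has_weak_integral_sum \<mu> n (\<lambda>i q. \<eta> i q \<cdot>\<^sub>q qinner (\<theta> i q) \<phi>) \<phi>"
  shows "ennreal ((norm \<phi>)\<^sup>2)
    \<le> (\<Sum>i=1..n. \<integral>\<^sup>+ q. ennreal (norm (qinner (\<eta> i q) \<phi>) * norm (qinner (\<theta> i q) \<phi>)) \<partial>\<mu>)"
proof -
  let ?f = "\<lambda>i q. qinner \<phi> (\<eta> i q \<cdot>\<^sub>q qinner (\<theta> i q) \<phi>)"
  have int: "integrable \<mu> (?f i)" if "i \<in> {1..n}" for i
    using assms that unfolding has_weak_integral_sum_def by blast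
  have "qinner \<phi> \<phi> = (\<Sum>i=1..n. \<integral>q. ?f i q \<partial>\<mu>)"
    using assms unfolding has_weak_integral_sum_def by simp
  then have "(norm \<phi>)\<^sup>2 = norm (\<Sum>i=1..n. \<integral>q. ?f i q \<partial>\<mu>)"
    by (metis abs_of_nonneg norm_of_real qinner_self zero_le_power2)
  also have "\<dots> \<le> (\<Sum>i=1..n. norm (\<integral>q. ?f i q \<partial>\<mu>))"
    by (rule norm_sum)
  finally have "ennreal ((norm \<phi>)\<^sup>2) \<le> (\<Sum>i=1..n. ennreal (norm (\<integral>q. ?f i q \<partial>\<mu>)))"
    by (simp add: ennreal_leI)
  also have "\<dots> \<le> (\<Sum>i=1..n. \<integral>\<^sup>+ q. norm (?f i q) \<partial>\<mu>)"
    by (intro sum_mono integral_norm_bound_ennreal int)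
  also have "\<dots> = (\<Sum>i=1..n. \<integral>\<^sup>+ q. ennreal (norm (qinner (\<eta> i q) \<phi>) * norm (qinner (\<theta> i q) \<phi>)) \<partial>\<mu>)"
    by (simp add: qinner_rscale_right norm_mult norm_qinner_commute [of \<phi>])
  finally show ?thesis .
qed

section \<open>Frame bounds of the perturbed family\<close>

theorem theorem3p4:
  fixes \<mu> :: "quat measure" and n :: nat
    and \<eta> \<eta>' \<Psi> :: "nat \<Rightarrow> quat \<Rightarrow> 'v::right_quat_hilbert"
    and A :: "'v \<Rightarrow> 'v" and C D :: real and lam \<gamma> :: ennreal
  assumes "space \<mu> = UNIV" and "n \<ge> 1"
    and frame: "rank_frame_with_operator \<mu> n \<eta> A"
    and dual: "dual_frame_with_bounds \<mu> n \<eta> \<eta>' C D"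
    and meas: "measurable_family \<mu> n \<Psi>"
    and lam: "lam = (\<Sum>i=1..n. \<integral>\<^sup>+ q. ennreal ((norm (\<eta> i q - \<Psi> i q))\<^sup>2) \<partial>\<mu>)" "lam < \<infinity>"
    and \<gamma>: "\<gamma> = (\<Sum>i=1..n. \<integral>\<^sup>+ q. ennreal (norm (\<eta> i q - \<Psi> i q) * norm (\<eta>' i q)) \<partial>\<mu>)" "\<gamma> < 1"
  shows "rank_frame_with_bounds \<mu> n \<Psi> ((1 - enn2real \<gamma>)\<^sup>2 / D)
    (operator_sup A * (1 + sqrt (enn2real lam / operator_sup A))\<^sup>2)"
proof -
  let ?F = "\<lambda>\<xi> \<phi>. \<Sum>i=1..n. \<integral>\<^sup>+ q. ennreal ((norm (qinner (\<xi> i q) \<phi>))\<^sup>2) \<partial>\<mu>"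
  let ?M = "operator_sup A"
  define l g where "l = enn2real lam" and "g = enn2real \<gamma>"
  \<comment> \<open>\<open>enn2real\<close> sends infinity to 0, so finiteness is what makes
    \<open>l\<close> and \<open>g\<close> faithful copies of \<open>lam\<close> and
    \<gamma>.\<close>
  have l: "lam = ennreal l" "l \<ge> 0"
    using lam(2) by (simp_all add: l_def)
  have "\<gamma> < \<infinity>"
    using \<gamma>(2) by (rule less_trans) simp
  then have g: "\<gamma> = ennreal g" "g \<ge> 0"
    by (simp_all add: g_def)
  then have g1: "g < 1"
    using \<gamma>(2) by simp
  from frame have A: "bounded_right_linear A"
    and \<eta>_meas: "\<And>i. i \<in> {1..n} \<Longrightarrow> \<eta> i \<in> borel_measurable \<mu>"
    and indep: "right_independent n (\<lambda>i. \<eta> i 0)"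
    and A_eq: "\<And>\<phi>. has_weak_integral_sum \<mu> n (\<lambda>i q. ket_bra (\<eta> i q) (\<eta> i q) \<phi>) (A \<phi>)"
    by (auto simp: rank_frame_with_operator_def bounded_with_bounded_inverse_def
        measurable_family_def)
  from dual have D: "D > 0" and \<eta>'_meas: "\<And>i. i \<in> {1..n} \<Longrightarrow> \<eta>' i \<in> borel_measurable \<mu>"
    and D_bound: "\<And>\<phi>. ?F \<eta>' \<phi> \<le> ennreal (D * (norm \<phi>)\<^sup>2)"
    and rec: "\<And>\<phi>. has_weak_integral_sum \<mu> n (\<lambda>i q. \<eta> i q \<cdot>\<^sub>q qinner (\<eta>' i q) \<phi>) \<phi>"
    by (auto simp: dual_frame_with_bounds_def rank_frame_with_bounds_def measurable_family_def)
  have \<Psi>_meas: "\<And>i. i \<in> {1..n} \<Longrightarrow> \<Psi> i \<in> borel_measurable \<mu>"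
    using meas by (simp add: measurable_family_def)
  have F_\<eta>: "?F \<eta> \<phi> \<le> ennreal (?M * (norm \<phi>)\<^sup>2)" for \<phi>
    unfolding frame_operator_eq [OF A_eq] by (intro ennreal_leI qRe_le_operator_sup A)
  \<comment> \<open>If \<open>?M\<close> were not positive, the frame sums of \<eta> would vanish,
    since \<open>ennreal\<close> truncates negative reals to 0; reconstruction would then force
    every vector to be 0.\<close>
  have M: "?M > 0"
  proof (rule ccontr)
    assume "\<not> ?M > 0"
    then have F0: "?F \<eta> \<phi> = 0" for \<phi>
      using F_\<eta> [of \<phi>] mult_nonpos_nonneg [of ?M "(norm \<phi>)\<^sup>2"] by (simp add: ennreal_neg)
    have zero: "\<phi> = 0" for \<phi> :: 'v
    proof -
      have "(\<integral>\<^sup>+ q. ennreal (norm (qinner (\<eta> i q) \<phi>) * norm (qinner (\<eta>' i q) \<phi>)) \<partial>\<mu>) = 0"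
        if i: "i \<in> {1..n}" for i
      proof -
        note [measurable] = borel_measurable_norm_qinner [OF \<eta>_meas [OF i]]
          borel_measurable_norm_qinner [OF \<eta>'_meas [OF i]]
        have "(\<integral>\<^sup>+ q. ennreal ((norm (qinner (\<eta> i q) \<phi>))\<^sup>2) \<partial>\<mu>) = 0"
          using F0 [of \<phi>] i by simp
        then have "AE q in \<mu>. norm (qinner (\<eta> i q) \<phi>) = 0"
          by (subst (asm) nn_integral_0_iff_AE) (auto simp: ennreal_eq_0_iff)
        then show ?thesis
          by (subst nn_integral_0_iff_AE) auto
      qed
      then show ?thesis
        using dual_norm_le [OF rec, of \<phi>] by (simp add: ennreal_eq_0_iff)
    qed
    \<comment> \<open>In the zero space the combination with all coefficients 1 vanishes, against
      independence of \<eta> at the point 0; \<open>n \<ge> 1\<close> provides an index.\<close>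
    have "\<forall>i\<in>{1..n}. (1::quat) = 0"
      using indep zero unfolding right_independent_def
      by (elim allE [where x = "\<lambda>_. 1"]) blast
    then show False
      using \<open>n \<ge> 1\<close> by simp
  qed
  have upper: "?F \<Psi> \<phi> \<le> ennreal (?M * (1 + sqrt (l / ?M))\<^sup>2 * (norm \<phi>)\<^sup>2)" for \<phi>
  proof (cases "\<phi> = 0")
    \<comment> \<open>Treated apart because \<open>sqrt ?M * norm \<phi>\<close> plays the role of
      \<open>P\<close> in Minkowski's inequality and must be positive.\<close>
    case True
    then show ?thesis
      by simp
  next
    case False
    let ?b = "\<lambda>i q. norm (\<eta> i q - \<Psi> i q) * norm \<phi>"
    have "?F \<Psi> \<phi> \<le> (\<Sum>i=1..n. \<integral>\<^sup>+ q. ennreal ((norm (qinner (\<eta> i q) \<phi>) + ?b i q)\<^sup>2) \<partial>\<mu>)"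
    proof (intro sum_mono nn_integral_mono ennreal_leI power_mono)
      fix i q
      have "qinner (\<Psi> i q) \<phi> = qinner (\<eta> i q) \<phi> - qinner (\<eta> i q - \<Psi> i q) \<phi>"
        by (simp add: qinner_diff_left)
      then show "norm (qinner (\<Psi> i q) \<phi>) \<le> norm (qinner (\<eta> i q) \<phi>) + ?b i q"
        using norm_triangle_ineq4 [of "qinner (\<eta> i q) \<phi>" "qinner (\<eta> i q - \<Psi> i q) \<phi>"]
          norm_qinner_le [of "\<eta> i q - \<Psi> i q" \<phi>] by simp
    qed simp
    also have "\<dots> \<le> ennreal ((sqrt ?M * norm \<phi> + sqrt l * norm \<phi>)\<^sup>2)"
    proof (rule sum_nn_integral_Minkowski)
      show "?F \<eta> \<phi> \<le> ennreal ((sqrt ?M * norm \<phi>)\<^sup>2)"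
        using F_\<eta> [of \<phi>] M by (simp add: power_mult_distrib)
      have "(\<Sum>i=1..n. \<integral>\<^sup>+ q. ennreal ((?b i q)\<^sup>2) \<partial>\<mu>) = lam * ennreal ((norm \<phi>)\<^sup>2)"
        unfolding lam(1) sum_distrib_right
      proof (rule sum.cong [OF refl])
        fix i assume i: "i \<in> {1..n}"
        note [measurable] = \<eta>_meas [OF i] \<Psi>_meas [OF i]
        show "(\<integral>\<^sup>+ q. ennreal ((?b i q)\<^sup>2) \<partial>\<mu>)
            = (\<integral>\<^sup>+ q. ennreal ((norm (\<eta> i q - \<Psi> i q))\<^sup>2) \<partial>\<mu>) * ennreal ((norm \<phi>)\<^sup>2)"
          by (subst nn_integral_multc [symmetric]) (auto simp: power_mult_distrib ennreal_mult)
      qed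
      then show "(\<Sum>i=1..n. \<integral>\<^sup>+ q. ennreal ((?b i q)\<^sup>2) \<partial>\<mu>) \<le> ennreal ((sqrt l * norm \<phi>)\<^sup>2)"
        using l by (simp add: power_mult_distrib ennreal_mult)
      show "(\<lambda>q. norm (qinner (\<eta> i q) \<phi>)) \<in> borel_measurable \<mu>" if "i \<in> {1..n}" for i
        by (rule borel_measurable_norm_qinner [OF \<eta>_meas [OF that]])
      show "?b i \<in> borel_measurable \<mu>" if i: "i \<in> {1..n}" for i
      proof -
        note [measurable] = \<eta>_meas [OF i] \<Psi>_meas [OF i]
        show ?thesis
          by measurable
      qed
    qed (use M l False in simp_all)
    also have "(sqrt ?M * norm \<phi> + sqrt l * norm \<phi>)\<^sup>2 = (sqrt ?M * (1 + sqrt (l / ?M)))\<^sup>2 * (norm \<phi>)\<^sup>2"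
      using M by (simp add: real_sqrt_divide power_mult_distrib [symmetric] algebra_simps)
    also have "\<dots> = ?M * (1 + sqrt (l / ?M))\<^sup>2 * (norm \<phi>)\<^sup>2"
      using M by (simp add: power_mult_distrib)
    finally show ?thesis .
  qed
  have lower: "ennreal ((1 - g)\<^sup>2 / D * (norm \<phi>)\<^sup>2) \<le> ?F \<Psi> \<phi>" for \<phi>
  proof -
    let ?N = "(norm \<phi>)\<^sup>2"
    \<comment> \<open>Young's inequality with parameter \<open>s\<close> leaves
      \<open>D * ?N / (2 * s)\<close> from the dual frame. This choice makes that term half of
      \<open>(1 - g) * ?N\<close>, so it is absorbed, and it maximizes the resulting lower
      bound.\<close>
    define s where "s = D / (1 - g)"
    have s: "s > 0"
      using D g1 by (simp add: s_def)
    let ?e = "\<lambda>i q. norm (\<eta> i q - \<Psi> i q) * norm (\<eta>' i q)"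
    have "(\<integral>\<^sup>+ q. ennreal (norm (qinner (\<eta> i q) \<phi>) * norm (qinner (\<eta>' i q) \<phi>)) \<partial>\<mu>)
        \<le> ennreal (s / 2) * (\<integral>\<^sup>+ q. ennreal ((norm (qinner (\<Psi> i q) \<phi>))\<^sup>2) \<partial>\<mu>)
          + ennreal (1 / (2 * s)) * (\<integral>\<^sup>+ q. ennreal ((norm (qinner (\<eta>' i q) \<phi>))\<^sup>2) \<partial>\<mu>)
          + ennreal ?N * (\<integral>\<^sup>+ q. ennreal (?e i q) \<partial>\<mu>)" if i: "i \<in> {1..n}" for i
    proof -
      note [measurable] = \<eta>_meas [OF i] \<Psi>_meas [OF i] \<eta>'_meas [OF i]
        borel_measurable_norm_qinner [OF \<eta>'_meas [OF i]]
        borel_measurable_norm_qinner [OF \<Psi>_meas [OF i]]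
      \<comment> \<open>Splitting \<eta> as \<Psi> plus the difference: the \<Psi> product goes
        through Young, and the difference product through Cauchy-Schwarz twice, which yields the
        integrand of \<gamma>.\<close>
      have pt: "norm (qinner (\<eta> i q) \<phi>) * norm (qinner (\<eta>' i q) \<phi>)
          \<le> s / 2 * (norm (qinner (\<Psi> i q) \<phi>))\<^sup>2 + 1 / (2 * s) * (norm (qinner (\<eta>' i q) \<phi>))\<^sup>2
            + ?N * ?e i q" for q
      proof -
        let ?a = "norm (qinner (\<Psi> i q) \<phi>)" and ?d = "norm (qinner (\<eta> i q - \<Psi> i q) \<phi>)"
          and ?c = "norm (qinner (\<eta>' i q) \<phi>)"
        have "norm (qinner (\<eta> i q) \<phi>) * ?c \<le> (?a + ?d) * ?c"
          using norm_triangle_ineq [of "qinner (\<Psi> i q) \<phi>" "qinner (\<eta> i q - \<Psi> i q) \<phi>"]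
          by (intro mult_right_mono) (simp_all add: qinner_diff_left)
        also have "\<dots> = ?a * ?c + ?d * ?c"
          by (rule distrib_right)
        also have "?d * ?c \<le> (norm (\<eta> i q - \<Psi> i q) * norm \<phi>) * (norm (\<eta>' i q) * norm \<phi>)"
          by (intro mult_mono norm_qinner_le) simp_all
        also have "\<dots> = ?N * ?e i q"
          by (simp add: power2_eq_square)
        also have "?a * ?c \<le> s / 2 * ?a\<^sup>2 + 1 / (2 * s) * ?c\<^sup>2"
          using young_weighted [OF s, of ?a ?c] by simp
        finally show ?thesis
          by simp
      qed
      have "(\<integral>\<^sup>+ q. ennreal (norm (qinner (\<eta> i q) \<phi>) * norm (qinner (\<eta>' i q) \<phi>)) \<partial>\<mu>)
          \<le> (\<integral>\<^sup>+ q. ennreal (s / 2) * ennreal ((norm (qinner (\<Psi> i q) \<phi>))\<^sup>2)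
            + ennreal (1 / (2 * s)) * ennreal ((norm (qinner (\<eta>' i q) \<phi>))\<^sup>2)
            + ennreal ?N * ennreal (?e i q) \<partial>\<mu>)"
      proof (rule nn_integral_mono)
        fix q
        show "ennreal (norm (qinner (\<eta> i q) \<phi>) * norm (qinner (\<eta>' i q) \<phi>))
          \<le> ennreal (s / 2) * ennreal ((norm (qinner (\<Psi> i q) \<phi>))\<^sup>2)
            + ennreal (1 / (2 * s)) * ennreal ((norm (qinner (\<eta>' i q) \<phi>))\<^sup>2)
            + ennreal ?N * ennreal (?e i q)"
          using ennreal_leI [OF pt [of q]] s
          by (simp add: ennreal_mult del: times_divide_eq_left times_divide_eq_right)
      qed
      also have "\<dots> = ennreal (s / 2) * (\<integral>\<^sup>+ q. ennreal ((norm (qinner (\<Psi> i q) \<phi>))\<^sup>2) \<partial>\<mu>)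
          + ennreal (1 / (2 * s)) * (\<integral>\<^sup>+ q. ennreal ((norm (qinner (\<eta>' i q) \<phi>))\<^sup>2) \<partial>\<mu>)
          + ennreal ?N * (\<integral>\<^sup>+ q. ennreal (?e i q) \<partial>\<mu>)"
        by (simp add: nn_integral_add nn_integral_cmult)
      finally show ?thesis .
    qed
    then have "(\<Sum>i=1..n. \<integral>\<^sup>+ q. ennreal (norm (qinner (\<eta> i q) \<phi>) * norm (qinner (\<eta>' i q) \<phi>)) \<partial>\<mu>)
        \<le> ennreal (s / 2) * ?F \<Psi> \<phi> + ennreal (1 / (2 * s)) * ?F \<eta>' \<phi> + ennreal ?N * \<gamma>"
      unfolding \<gamma>(1) sum_distrib_left sum.distrib [symmetric] by (rule sum_mono)
    with dual_norm_le [OF rec]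
    have "ennreal ?N \<le> ennreal (s / 2) * ?F \<Psi> \<phi> + ennreal (1 / (2 * s)) * ?F \<eta>' \<phi> + ennreal ?N * \<gamma>"
      by (rule order_trans)
    also have "\<dots> \<le> ennreal (s / 2) * ?F \<Psi> \<phi> + ennreal (1 / (2 * s)) * ennreal (D * ?N) + ennreal ?N * \<gamma>"
      by (intro add_mono mult_left_mono D_bound order_refl) simp
    finally have main: "ennreal ?N
      \<le> ennreal (s / 2) * ?F \<Psi> \<phi> + ennreal (1 / (2 * s)) * ennreal (D * ?N) + ennreal ?N * \<gamma>" .
    \<comment> \<open>The upper bound makes the frame sum finite, so the inequality can be read in
      the reals, where the absorbed terms may be subtracted.\<close>
    have "?F \<Psi> \<phi> < \<infinity>"
      using upper [of \<phi>] by (rule le_less_trans) simp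
    then obtain f where f: "?F \<Psi> \<phi> = ennreal f" "f \<ge> 0"
      by (cases "?F \<Psi> \<phi>") auto
    have "ennreal ?N \<le> ennreal (s / 2 * f + 1 / (2 * s) * (D * ?N) + ?N * g)"
      using main s D f g
      by (simp add: ennreal_mult del: times_divide_eq_left times_divide_eq_right)
    then have "?N \<le> s / 2 * f + 1 / (2 * s) * (D * ?N) + ?N * g"
      using s D f(2) g(2) by (subst (asm) ennreal_le_iff) simp_all
    moreover have "1 / (2 * s) * (D * ?N) = (1 - g) * ?N / 2"
      using D g1 by (simp add: s_def)
    ultimately have "(1 - g) * ?N \<le> s * f"
      by (simp add: algebra_simps)
    then have "(1 - g)\<^sup>2 / D * ?N \<le> f"
      using D g1 by (simp add: s_def field_simps power2_eq_square)
    then show ?thesis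
      unfolding f(1) by (rule ennreal_leI)
  qed
  have "0 < (1 - g)\<^sup>2 / D"
    using D g1 by simp
  moreover have "0 < ?M * (1 + sqrt (l / ?M))\<^sup>2"
    using M l(2) by (intro mult_pos_pos zero_less_power add_pos_nonneg) simp_all
  ultimately show ?thesis
    using upper lower meas unfolding rank_frame_with_bounds_def l_def g_def by blast
qed

end
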